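(* Let $\mathcal{H}$ be a complex Hilbert space and let $B$ and $C$ be linear operators in $\mathcal{H}$ such that $B^2$ is m-accretive, $C$ is accretive, $\mathcal{D}(B^2)\subset\mathcal{D}(C)$, and there exist $\alpha\ge 0$, $0\le\beta<1$, $\delta\ge 0$ with $$\operatorname{Re}\langle B^2x,Cx\rangle\ge -\alpha\|x\|^2-\beta\|B^2x\|^2-\delta\|B^2x\|\,\|x\|\qquad\text{for all }x\in\mathcal{D}(B^2).$$ Let $\Lambda=B^2+C$ with domain $\mathcal{D}(B^2)$, let $Z_1=B+\Lambda^{1/2}$ and $Z_2=B-\Lambda^{1/2}$, both with domain $\mathcal{D}(B)\cap\mathcal{D}(\Lambda^{1/2})$, and for $\lambda\in\mathbb{C}$ let $Q(\lambda)=\lambda^2I-2\lambda B-C$ with domain $\mathcal{D}(B)\cap\mathcal{D}(C)$. Assume that $B(\mathcal{D}(B^2))\subset\mathcal{D}(B^2)$ and $\Lambda^{1/2}(\mathcal{D}(B^2))\subset\mathcal{D}(B^2)$. Then, for every $\lambda\in\mathbb{C}$, $$Q(\lambda)x=\tfrac12(\lambda I-Z_1)(\lambda I-Z_2)x+\tfrac12(\lambda I-Z_2)(\lambda I-Z_1)x\qquad\text{for all }x\in\mathcal{D}(B^2).$$ In particular, if $B\Lambda^{1/2}=\Lambda^{1/2}B$ on $\mathcal{D}(B^2)$, then, for every $\lambda\in\mathbb{C}$, $$Q(\lambda)x=(\lambda I-Z_1)(\lambda I-Z_2)x=(\lambda I-Z_2)(\lambda I-Z_1)x\qquad\text{for all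 }x\in\mathcal{D}(B^2).$$
   Context: A linear operator $T$ in $\mathcal{H}$ is accretive if $\operatorname{Re}\langle Tx,x\rangle\ge 0$ for all $x\in\mathcal{D}(T)$; an accretive operator is m-accretive if it is densely defined and $\mathcal{R}(\lambda+T)=\mathcal{H}$ for some (hence every) $\lambda>0$. Under the stated hypotheses $\Lambda$ is m-accretive, and $\Lambda^{1/2}$ denotes its unique m-$(\pi/4)$-accretive square root, where, for $\omega\in[0,\pi/2)$, $T$ is m-$\omega$-accretive if it is m-accretive and $|\operatorname{Im}\langle Tx,x\rangle|\le\tan\omega\,\operatorname{Re}\langle Tx,x\rangle$ for all $x\in\mathcal{D}(T)$. $B^2$ has its natural domain $\{x\in\mathcal{D}(B): Bx\in\mathcal{D}(B)\}$. *)

theory Defs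
  imports "HOL-Analysis.Analysis"
begin

section \<open>Complex Hilbert spaces\<close>

text \<open>
  The inner product is linear in its first argument. The real inner product underlying the
  norm and the topology is the real part of the complex one.
\<close>

class complex_inner = real_inner +
  fixes scaleC :: "complex \<Rightarrow> 'a \<Rightarrow> 'a" (infixr "*\<^sub>C" 75)
    and cinner :: "'a \<Rightarrow> 'a \<Rightarrow> complex"
  assumes scaleC_add_right: "c *\<^sub>C (x + y) = c *\<^sub>C x + c *\<^sub>C y"
    and scaleC_add_left: "(c + d) *\<^sub>C x = c *\<^sub>C x + d *\<^sub>C x"
    and scaleC_scaleC: "c *\<^sub>C d *\<^sub>C x = (c * d) *\<^sub>C x"
    and scaleC_of_real: "complex_of_real r *\<^sub>C x = r *\<^sub>R x"
    and cinner_commute: "cinner x y = cnj (cinner y x)"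
    and cinner_add_left: "cinner (x + y) z = cinner x z + cinner y z"
    and cinner_scaleC_left: "cinner (c *\<^sub>C x) y = c * cinner x y"
    and inner_eq_Re_cinner: "inner x y = Re (cinner x y)"

class complex_hilbert = complex_inner + complete_space

instantiation complex :: complex_hilbert
begin

definition scaleC_complex :: "complex \<Rightarrow> complex \<Rightarrow> complex"
  where "scaleC_complex c x = c * x"

definition cinner_complex :: "complex \<Rightarrow> complex \<Rightarrow> complex"
  where "cinner_complex x y = x * cnj y"

instance
  by standard (simp_all add: scaleC_complex_def cinner_complex_def inner_complex_def
      algebra_simps scaleR_conv_of_real)

end

section \<open>Unbounded operators\<close>

text \<open>
  An operator in a space is a partial map: \<open>dom T\<close> is its domain, \<open>T x = Some y\<close> means that
  \<open>x\<close> belongs to the domain and is mapped to \<open>y\<close>, and \<open>ran T\<close> is the range. Two operators are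
  equal iff they have the same domain and agree on it. The product \<open>S T\<close> with its natural
  domain is \<open>S \<circ>\<^sub>m T\<close>, the identity is \<open>Some\<close>, and the image of a set \<open>D\<close> is \<open>ran (T |` D)\<close>.
  Sums and differences live on the intersection of the domains.
\<close>

type_synonym 'a operator = "'a \<rightharpoonup> 'a"

definition linear_op :: "'a::complex_inner operator \<Rightarrow> bool" where
  "linear_op T \<longleftrightarrow>
     T 0 = Some 0 \<and>
     (\<forall>x y u v. T x = Some u \<longrightarrow> T y = Some v \<longrightarrow> T (x + y) = Some (u + v)) \<and>
     (\<forall>c x u. T x = Some u \<longrightarrow> T (c *\<^sub>C x) = Some (c *\<^sub>C u))"

definition op_add :: "'a::complex_inner operator \<Rightarrow> 'a operator \<Rightarrow> 'a operator"
    (infixl "+\<^sub>o" 65) where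
  "S +\<^sub>o T = (\<lambda>x. if x \<in> dom S \<inter> dom T then Some (the (S x) + the (T x)) else None)"

definition op_diff :: "'a::complex_inner operator \<Rightarrow> 'a operator \<Rightarrow> 'a operator"
    (infixl "-\<^sub>o" 65) where
  "S -\<^sub>o T = (\<lambda>x. if x \<in> dom S \<inter> dom T then Some (the (S x) - the (T x)) else None)"

definition op_scale :: "complex \<Rightarrow> 'a::complex_inner operator \<Rightarrow> 'a operator"
    (infixr "*\<^sub>o" 75) where
  "c *\<^sub>o T = (\<lambda>x. map_option (scaleC c) (T x))"

definition accretive :: "'a::complex_inner operator \<Rightarrow> bool" where
  "accretive T \<longleftrightarrow> linear_op T \<and> (\<forall>x\<in>dom T. Re (cinner (the (T x)) x) \<ge> 0)"

definition m_accretive :: "'a::complex_inner operator \<Rightarrow> bool" where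
  "m_accretive T \<longleftrightarrow>
     accretive T \<and> closure (dom T) = UNIV \<and>
     (\<exists>r::real. r > 0 \<and> ran (complex_of_real r *\<^sub>o Some +\<^sub>o T) = UNIV)"

definition m_angle_accretive :: "real \<Rightarrow> 'a::complex_inner operator \<Rightarrow> bool" where
  "m_angle_accretive \<omega> T \<longleftrightarrow>
     m_accretive T \<and>
     (\<forall>x\<in>dom T. \<bar>Im (cinner (the (T x)) x)\<bar> \<le> tan \<omega> * Re (cinner (the (T x)) x))"

text \<open>
  The definite description is meaningful for m-accretive \<open>T\<close>, which have exactly one
  m-(pi/4)-accretive square root; the equation \<open>S \<circ>\<^sub>m S = T\<close> includes equality of domains.
\<close>

definition op_sqrt :: "'a::complex_inner operator \<Rightarrow> 'a operator" where
  "op_sqrt T = (THE S. m_angle_accretive (pi / 4) S \<and> S \<circ>\<^sub>m S = T)"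

end

theory Submission
  imports Defs
begin

text \<open>
  The invariance \<open>B(D) \<subseteq> D\<close> of \<open>D = dom (B\<^sup>2)\<close> is very strong: every vector is \<open>r x + B\<^sup>2 x\<close> for
  some \<open>x \<in> D\<close>, because \<open>B\<^sup>2\<close> is m-accretive, and \<open>B\<^sup>2 x = B (B x)\<close> is again in \<open>D\<close>. Hence \<open>D\<close> is the
  whole space (\<open>dom_square_eq_UNIV\<close>), so \<open>B\<close>, \<open>C\<close> and \<open>\<Lambda> = B\<^sup>2 + C\<close> are everywhere defined and \<open>\<Lambda>\<close> is
  accretive. An everywhere defined accretive operator is bounded by Baire category
  (\<open>monotone_linear_bounded\<close>), and the square root \<open>S\<close> of \<open>\<Lambda>\<close> is needed only for bounded operators.
  Once \<open>S\<close> is linear and \<open>S\<^sup>2 = \<Lambda>\<close>, expanding the products gives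
  \<open>(\<mu> - Z\<^sub>1)(\<mu> - Z\<^sub>2) = Q \<mu> - (B S - S B)\<close> and \<open>(\<mu> - Z\<^sub>2)(\<mu> - Z\<^sub>1) = Q \<mu> + (B S - S B)\<close>: the commutator
  cancels in the average, and vanishes if \<open>B\<close> and \<open>S\<close> commute.

  The root of a bounded accretive \<open>T\<close> is built without spectral calculus or adjoints. For \<open>s > 0\<close>
  the operator \<open>T + s\<^sup>2\<close> is coercive, so a small multiple of it is \<open>I - A\<close> with \<open>norm A < 1\<close>, and
  \<open>I - A\<close> has a root \<open>I - Y\<close>, where \<open>Y\<close> is the fixed point of the contraction \<open>Y \<mapsto> (A + Y\<^sup>2) / 2\<close> and
  commutes with everything that commutes with \<open>A\<close>. The resulting root \<open>P\<^sub>s\<close> of \<open>T + s\<^sup>2\<close> satisfies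
  \<open>Re \<langle>P\<^sub>s x, x\<rangle> \<ge> s (norm x)\<^sup>2\<close>, and the factorisation \<open>(P\<^sub>s + P\<^sub>t)(P\<^sub>s - P\<^sub>t) = s\<^sup>2 - t\<^sup>2\<close> then gives
  \<open>norm (P\<^sub>s - P\<^sub>t) \<le> \<bar>s - t\<bar>\<close> (\<open>shifted_roots_close\<close>). So \<open>P\<^sub>s\<close> converges as \<open>s \<rightarrow> 0\<close>, which is
  existence; the same estimate with \<open>t = 0\<close>, where \<open>P\<^sub>0\<close> may be any accretive root of \<open>T\<close>, shows that
  every such root is this limit, which is uniqueness.

  The lower bound for \<open>P\<^sub>s\<close> and the sector condition for \<open>S\<close> both come from one variational principle,
  \<open>rayleigh_lower_bound\<close>: at an almost minimiser of a Rayleigh quotient the derivative in a direction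
  of bounded length is almost zero.
\<close>

section \<open>Everywhere defined accretive operators are bounded\<close>

text \<open>
  Monotonicity at \<open>x - z\<close> bounds \<open>\<langle>T x, z\<rangle>\<close> by \<open>norm (T x) * norm x\<close> plus a constant depending only on
  \<open>z\<close>. So the functionals \<open>\<langle>T x, _\<rangle> / (1 + norm (T x) * norm x)\<close> with \<open>norm x \<le> 1\<close> are pointwise bounded,
  hence uniformly bounded by the Baire category theorem. For small \<open>x\<close> the term
  \<open>norm (T x) * norm x\<close> can then be absorbed, which leaves a bound on \<open>norm (T x)\<close>.
\<close>

lemma monotone_linear_bounded:
  fixes T :: "'a::{real_inner,banach} \<Rightarrow> 'a"
  assumes lin: "linear T" and mono: "\<And>x. inner (T x) x \<ge> 0"
  shows "bounded_linear T"
proof -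
  define E where "E n = {z. \<forall>x. norm x \<le> 1 \<longrightarrow> inner (T x) z \<le> real n * (1 + norm (T x) * norm x)}" for n
  have closed_E: "closed (E n)" for n
  proof -
    have "E n = (\<Inter>x\<in>cball 0 1. {z. inner (T x) z \<le> real n * (1 + norm (T x) * norm x)})"
      by (auto simp: E_def)
    moreover have "closed {z. inner (T x) z \<le> c}" for x c
      by (intro closed_Collect_le continuous_intros)
    ultimately show ?thesis by auto
  qed
  have cover: "\<exists>n. z \<in> E n" for z
  proof -
    define c where "c = norm (T z) * (norm z + 1)"
    obtain n :: nat where n: "max 1 c \<le> real n"
      using real_arch_simple by blast
    have "inner (T x) z \<le> real n * (1 + norm (T x) * norm x)" if "norm x \<le> 1" for x
    proof -
      have "0 \<le> inner (T (x - z)) (x - z)"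
        by (rule mono)
      then have "inner (T x) z \<le> inner (T x) x + inner (T z) (z - x)"
        by (simp add: linear_diff[OF lin] inner_diff_left inner_diff_right)
      also have "\<dots> \<le> norm (T x) * norm x + norm (T z) * norm (z - x)"
        by (intro add_mono norm_cauchy_schwarz)
      also have "norm (z - x) \<le> norm z + 1"
        using norm_triangle_ineq4[of z x] that by simp
      then have "norm (T z) * norm (z - x) \<le> c"
        unfolding c_def by (intro mult_left_mono) auto
      also have "norm (T x) * norm x + c \<le> real n * (norm (T x) * norm x) + real n"
      proof (intro add_mono)
        show "norm (T x) * norm x \<le> real n * (norm (T x) * norm x)"
          using mult_right_mono[of 1 "real n" "norm (T x) * norm x"] n by simp
      qed (use n in simp)
      finally show ?thesis by (simp add: algebra_simps)
    qed
    then show ?thesis by (auto simp: E_def)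
  qed
  have "\<exists>n. interior (E n) \<noteq> {}"
  proof (rule ccontr)
    assume "\<not> ?thesis"
    then have "interior (\<Union>(range E)) = {}"
      using Met_TC.metric_Baire_category_alt[of "range E"] closed_E
      by (auto simp: mcomplete_iff_complete complete_UNIV)
    moreover have "\<Union>(range E) = UNIV"
      using cover by blast
    ultimately show False by simp
  qed
  then obtain n z r where r: "r > 0" and ball: "ball z r \<subseteq> E n"
    using mem_interior by blast
  \<comment> \<open>Adding the inequality at \<open>- z\<close> to those on the ball around \<open>z\<close> gives one on a ball around \<open>0\<close>.\<close>
  obtain m where m: "- z \<in> E m"
    using cover by blast
  define N where "N = real n + real m + 1"
  have "N > 0" by (simp add: N_def)
  have near_0: "norm (T x) \<le> 4 * N / r" if x: "norm x \<le> 1" "norm x \<le> r / (4 * N)" for x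
  proof -
    \<comment> \<open>Testing against the direction of \<open>T x\<close> turns the bound on the functional into one on its norm.\<close>
    define u where "u = (r / 2) *\<^sub>R sgn (T x)"
    have "norm u < r"
      using r by (simp add: u_def norm_sgn)
    then have "z + u \<in> E n"
      using ball by (auto simp: dist_norm)
    then have "inner (T x) u \<le> (real n + real m) * (1 + norm (T x) * norm x)"
      using m x(1) by (fastforce simp: E_def inner_add_right algebra_simps)
    also have "\<dots> \<le> N * (1 + norm (T x) * norm x)"
      by (intro mult_right_mono) (auto simp: N_def)
    also have "inner (T x) u = r / 2 * norm (T x)"
      by (cases "T x = 0") (simp_all add: u_def sgn_div_norm dot_square_norm power2_eq_square)
    finally have "r / 2 * norm (T x) \<le> N + N * norm x * norm (T x)"
      by (simp add: algebra_simps)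
    moreover have "N * norm x * norm (T x) \<le> r / 4 * norm (T x)"
      using x(2) \<open>N > 0\<close> by (intro mult_right_mono) (auto simp: field_simps)
    ultimately have "r / 4 * norm (T x) \<le> N"
      by simp
    then show ?thesis
      using r by (simp add: field_simps)
  qed
  define K where "K = 4 * N / r"
  define \<rho> where "\<rho> = min 1 (r / (4 * N))"
  have "\<rho> > 0" using r \<open>N > 0\<close> by (simp add: \<rho>_def)
  show ?thesis
  proof (rule bounded_linear_intro[where K = "K / \<rho>"])
    fix x :: 'a
    show "norm (T x) \<le> norm x * (K / \<rho>)"
    proof (cases "x = 0")
      case True
      then show ?thesis by (simp add: linear_0[OF lin])
    next
      case False
      have "norm (T ((\<rho> / norm x) *\<^sub>R x)) \<le> K"
        unfolding K_def using False \<open>\<rho> > 0\<close> by (intro near_0) (auto simp: \<rho>_def)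
      then show ?thesis
        using False \<open>\<rho> > 0\<close> by (simp add: linear_scale[OF lin] field_simps)
    qed
  qed (simp_all add: linear_add[OF lin] linear_scale[OF lin])
qed

section \<open>A variational principle for numerical ranges\<close>

text \<open>
  The expression after \<open>c \<le>\<close> is the derivative at \<open>x\<close>, in the direction \<open>V x\<close>, of the Rayleigh quotient
  \<open>\<langle>R x, x\<rangle> / (norm x)\<^sup>2\<close>. If the infimum of the quotient were below \<open>m\<close>, then a step of fixed length
  along \<open>- V x\<close>, starting close enough to the infimum, would go below it. Attainment of the infimum,
  which may fail in infinite dimension, is avoided by keeping the derivative bounded away from \<open>0\<close>.
\<close>

lemma rayleigh_lower_bound:
  fixes R V :: "'a::real_inner \<Rightarrow> 'a"
  assumes R: "bounded_linear R" and V: "bounded_linear V"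
    and deriv: "\<And>k. k < m \<Longrightarrow> \<exists>c>0. \<forall>x. norm x = 1 \<longrightarrow> inner (R x) x \<le> k \<longrightarrow>
       c \<le> inner (R x) (V x) + inner (R (V x)) x - 2 * inner (R x) x * inner x (V x)"
  shows "m * (norm x)\<^sup>2 \<le> inner (R x) x"
proof -
  define q where "q x = inner (R x) x" for x
  obtain K where K: "\<And>x. norm (R x) \<le> norm x * K" and "K > 0"
    using bounded_linear.pos_bounded[OF R] by blast
  obtain L where L: "\<And>x. norm (V x) \<le> norm x * L" and "L > 0"
    using bounded_linear.pos_bounded[OF V] by blast
  have q_bound: "\<bar>q x\<bar> \<le> K * (norm x)\<^sup>2" for x
  proof -
    have "\<bar>q x\<bar> \<le> norm (R x) * norm x"
      unfolding q_def by (rule Cauchy_Schwarz_ineq2)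
    also have "\<dots> \<le> (norm x * K) * norm x"
      by (intro mult_right_mono K) simp
    finally show ?thesis by (simp add: power2_eq_square algebra_simps)
  qed
  have q_scale: "q (c *\<^sub>R x) = c\<^sup>2 * q x" for c x
    by (simp add: q_def linear_scale[OF bounded_linear.linear[OF R]] power2_eq_square)
  have unit: "m \<le> q x" if "norm x = 1" for x
  proof (rule ccontr)
    assume "\<not> m \<le> q x"
    define S where "S = {x :: 'a. norm x = 1}"
    define \<mu> where "\<mu> = Inf (q ` S)"
    have "x \<in> S" using that by (simp add: S_def)
    have bdd: "bdd_below (q ` S)"
    proof (rule bdd_belowI2)
      fix y assume "y \<in> S"
      then show "- K \<le> q y" using q_bound[of y] by (simp add: S_def)
    qed
    have \<mu>_le: "\<mu> * (norm y)\<^sup>2 \<le> q y" for y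
    proof (cases "y = 0")
      case True
      then show ?thesis by (simp add: q_def)
    next
      case False
      then have "\<mu> \<le> q ((1 / norm y) *\<^sub>R y)"
        unfolding \<mu>_def by (intro cINF_lower bdd) (simp add: S_def)
      with False show ?thesis by (simp add: q_scale field_simps)
    qed
    have "\<mu> < m"
      using cINF_lower[OF bdd \<open>x \<in> S\<close>] \<open>\<not> m \<le> q x\<close> by (simp add: \<mu>_def)
    define k where "k = (\<mu> + m) / 2"
    have k: "\<mu> < k" "k < m" using \<open>\<mu> < m\<close> by (simp_all add: k_def)
    obtain c where "c > 0" and c: "\<And>y. norm y = 1 \<Longrightarrow> q y \<le> k \<Longrightarrow>
        c \<le> inner (R y) (V y) + inner (R (V y)) y - 2 * q y * inner y (V y)"
      using deriv[OF k(2)] unfolding q_def by blast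
    define W where "W = (K + \<bar>\<mu>\<bar>) * L\<^sup>2"
    have "W > 0" using \<open>K > 0\<close> \<open>L > 0\<close> by (simp add: W_def)
    \<comment> \<open>With this step the first-order gain \<open>t * c\<close> is twice the second-order loss \<open>t\<^sup>2 * W\<close>.\<close>
    define t where "t = c / (2 * W)"
    have "t > 0" using \<open>c > 0\<close> \<open>W > 0\<close> by (simp add: t_def)
    define p where "p = 1 + 2 * t * L"
    have "p > 0" using \<open>t > 0\<close> \<open>L > 0\<close> by (simp add: p_def add_pos_pos)
    \<comment> \<open>The defect \<open>d\<close> from the infimum must be less than what remains of the gain after the loss.\<close>
    define d where "d = min (k - \<mu>) (t * c / 2 / p / 2)"
    have "d > 0" using k \<open>t > 0\<close> \<open>c > 0\<close> \<open>p > 0\<close> by (simp add: d_def)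
    have "\<exists>y\<in>S. q y < \<mu> + d"
      using cINF_less_iff[of S q "\<mu> + d"] bdd \<open>x \<in> S\<close> \<open>d > 0\<close> by (auto simp: \<mu>_def)
    then obtain y where y: "norm y = 1" "q y < \<mu> + d"
      by (auto simp: S_def)
    define e where "e = q y - \<mu>"
    have e: "0 \<le> e" "e < d" using \<mu>_le[of y] y by (simp_all add: e_def)
    have "q y \<le> k" using y(2) by (simp add: d_def)
    define g where "g = inner (R y) (V y) + inner (R (V y)) y - 2 * q y * inner y (V y)"
    have "c \<le> g" unfolding g_def by (rule c) fact+
    have normV: "norm (V y) \<le> L" using L[of y] y by simp
    have qV: "q (V y) - \<mu> * (norm (V y))\<^sup>2 \<le> W"
    proof -
      have "q (V y) - \<mu> * (norm (V y))\<^sup>2 \<le> K * (norm (V y))\<^sup>2 + \<bar>\<mu>\<bar> * (norm (V y))\<^sup>2"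
        using q_bound[of "V y"] mult_right_mono[OF abs_ge_minus_self[of \<mu>], of "(norm (V y))\<^sup>2"]
        by simp
      also have "\<dots> = (K + \<bar>\<mu>\<bar>) * (norm (V y))\<^sup>2" by (simp add: algebra_simps)
      also have "\<dots> \<le> W"
        unfolding W_def using \<open>K > 0\<close> normV by (intro mult_left_mono power_mono) auto
      finally show ?thesis .
    qed
    have "0 \<le> q (y - t *\<^sub>R V y) - \<mu> * (norm (y - t *\<^sub>R V y))\<^sup>2"
      using \<mu>_le[of "y - t *\<^sub>R V y"] by simp
    also have "\<dots> = e - t * (g + 2 * e * inner y (V y)) + t\<^sup>2 * (q (V y) - \<mu> * (norm (V y))\<^sup>2)"
      using y(1) unfolding e_def g_def q_def power2_norm_eq_inner norm_eq_1
      by (simp add: linear_diff[OF bounded_linear.linear[OF R]] linear_scale[OF bounded_linear.linear[OF R]]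
          inner_diff_left inner_diff_right inner_commute[of "V y" y] inner_commute power2_eq_square algebra_simps)
    also have "\<dots> \<le> e - t * (c - 2 * e * L) + t\<^sup>2 * W"
    proof -
      have "- L \<le> inner y (V y)"
        using Cauchy_Schwarz_ineq2[of y "V y"] normV y(1) by simp
      then have "- (2 * e * L) \<le> 2 * e * inner y (V y)"
        using mult_left_mono[of "- L" "inner y (V y)" "2 * e"] e(1) by simp
      then have "t * (c - 2 * e * L) \<le> t * (g + 2 * e * inner y (V y))"
        using \<open>c \<le> g\<close> \<open>t > 0\<close> by (intro mult_left_mono) linarith+
      moreover have "t\<^sup>2 * (q (V y) - \<mu> * (norm (V y))\<^sup>2) \<le> t\<^sup>2 * W"
        by (intro mult_left_mono qV) simp
      ultimately show ?thesis by simp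
    qed
    also have "t\<^sup>2 * W = t * c / 2"
      using \<open>W > 0\<close> by (simp add: t_def power2_eq_square)
    finally have "t * c / 2 \<le> e * p"
      by (simp add: p_def algebra_simps)
    also have "\<dots> \<le> d * p"
      using e \<open>p > 0\<close> by (intro mult_right_mono) auto
    also have "\<dots> \<le> t * c / 2 / p / 2 * p"
      using \<open>p > 0\<close> by (intro mult_right_mono) (auto simp: d_def)
    also have "\<dots> = t * c / 4"
      using \<open>p > 0\<close> by simp
    finally show False
      using \<open>t > 0\<close> \<open>c > 0\<close> by simp
  qed
  show ?thesis
  proof (cases "x = 0")
    case False
    then have "m \<le> q ((1 / norm x) *\<^sub>R x)" by (intro unit) simp
    with False show ?thesis by (simp add: q_scale flip: q_def) (simp add: field_simps)
  qed simp
qed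

text \<open>
  Moving along \<open>V = S\<close> from a unit vector \<open>x\<close> changes the Rayleigh quotient \<open>q\<close> of \<open>S\<close> at the rate
  \<open>(norm (S x))\<^sup>2 + \<langle>S\<^sup>2 x, x\<rangle> - 2 q\<^sup>2 \<ge> s\<^sup>2 - q\<^sup>2\<close>, as \<open>q\<^sup>2 \<le> (norm (S x))\<^sup>2\<close>; this is positive for \<open>0 \<le> q < s\<close>.
\<close>

lemma sqrt_lower_bound:
  fixes S :: "'a::real_inner \<Rightarrow> 'a"
  assumes S: "bounded_linear S" and mono: "\<And>x. inner (S x) x \<ge> 0"
    and sq: "\<And>x. s\<^sup>2 * (norm x)\<^sup>2 \<le> inner (S (S x)) x"
  shows "s * (norm x)\<^sup>2 \<le> inner (S x) x"
proof (rule rayleigh_lower_bound[OF S S])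
  fix k assume "k < s"
  show "\<exists>c>0. \<forall>x. norm x = 1 \<longrightarrow> inner (S x) x \<le> k \<longrightarrow>
       c \<le> inner (S x) (S x) + inner (S (S x)) x - 2 * inner (S x) x * inner x (S x)"
  proof (cases "k \<ge> 0")
    case False
    then have "\<not> inner (S x) x \<le> k" for x
      using mono[of x] by linarith
    then show ?thesis by (intro exI[of _ 1]) simp
  next
    case True
    have "s\<^sup>2 - k\<^sup>2 \<le> inner (S x) (S x) + inner (S (S x)) x - 2 * inner (S x) x * inner x (S x)"
      if x: "norm x = 1" "inner (S x) x \<le> k" for x
    proof -
      have "\<bar>inner (S x) x\<bar> \<le> norm (S x)"
        using Cauchy_Schwarz_ineq2[of "S x" x] x by simp
      then have "(inner (S x) x)\<^sup>2 \<le> inner (S x) (S x)"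
        using power_mono[of "\<bar>inner (S x) x\<bar>" "norm (S x)" 2] by (simp add: power2_norm_eq_inner)
      moreover have "(inner (S x) x)\<^sup>2 \<le> k\<^sup>2"
        using mono x by (intro power_mono) auto
      ultimately show ?thesis
        using sq[of x] x by (simp add: inner_commute[of x] power2_eq_square)
    qed
    moreover have "s\<^sup>2 - k\<^sup>2 > 0"
      using True \<open>k < s\<close> by (simp add: power_strict_mono)
    ultimately show ?thesis by blast
  qed
qed

text \<open>
  For \<open>J\<close> multiplication by \<open>\<i>\<close> or \<open>- \<i>\<close> the conclusion bounds the imaginary part of \<open>\<langle>S x, x\<rangle>\<close> by its
  real part from one side. With \<open>R = S + J S\<close> and \<open>V = S - J S\<close> the vectors \<open>R x\<close> and \<open>V x\<close> are
  orthogonal and \<open>R V = 2 S\<^sup>2\<close>, so the derivative of the Rayleigh quotient \<open>q\<close> of \<open>R\<close> along \<open>V\<close> is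
  \<open>2 \<langle>S\<^sup>2 x, x\<rangle> - 2 q \<langle>x, V x\<rangle>\<close>. Since \<open>q + \<langle>x, V x\<rangle> = 2 \<langle>S x, x\<rangle> \<ge> 0\<close>, it is at least \<open>2 q\<^sup>2\<close>
  wherever \<open>q < 0\<close>.
\<close>

lemma sqrt_sector_bound:
  fixes S J :: "'a::real_inner \<Rightarrow> 'a"
  assumes S: "bounded_linear S" and J: "bounded_linear J"
    and JJ: "\<And>x. J (J x) = - x" and skew: "\<And>x. inner (J x) x = 0"
    and SJ: "\<And>x. S (J x) = J (S x)"
    and mono: "\<And>x. inner (S x) x \<ge> 0" and mono2: "\<And>x. inner (S (S x)) x \<ge> 0"
  shows "0 \<le> inner (S x) x + inner (J (S x)) x"
proof -
  note linS = bounded_linear.linear[OF S] and linJ = bounded_linear.linear[OF J]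
  have J_adj: "inner (J u) v = - inner u (J v)" for u v
    using skew[of "u + v"] skew[of u] skew[of v]
    by (simp add: linear_add[OF linJ] inner_add_left inner_add_right inner_commute[of u])
  define R where "R x = S x + J (S x)" for x
  define V where "V x = S x - J (S x)" for x
  have R: "bounded_linear R" and V: "bounded_linear V"
    unfolding R_def V_def
    by (intro bounded_linear_add bounded_linear_sub S bounded_linear_compose[OF J])+
  have "0 * (norm x)\<^sup>2 \<le> inner (R x) x"
  proof (rule rayleigh_lower_bound[OF R V])
    fix k :: real assume "k < 0"
    have "2 * k\<^sup>2 \<le> inner (R x) (V x) + inner (R (V x)) x - 2 * inner (R x) x * inner x (V x)"
      if x: "inner (R x) x \<le> k" for x
    proof -
      have "inner (R x) (V x) = 0"
        unfolding R_def V_def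
        using skew[of "S x"] by (simp add: inner_add_left inner_diff_right J_adj JJ)
      moreover have "R (V x) = 2 *\<^sub>R S (S x)"
        unfolding R_def V_def
        by (simp add: linear_diff[OF linS] linear_diff[OF linJ] linear_add[OF linS] SJ JJ scaleR_2)
      moreover have "- inner (R x) x \<le> inner x (V x)"
        unfolding inner_commute[of x "V x"]
        using mono[of x] by (simp add: R_def V_def inner_add_left inner_diff_left)
      then have "k\<^sup>2 \<le> - inner (R x) x * inner x (V x)"
        using x \<open>k < 0\<close> mult_mono[of "- k" "- inner (R x) x" "- k" "inner x (V x)"]
        by (simp add: power2_eq_square)
      ultimately show ?thesis
        using mono2[of x] by simp
    qed
    moreover have "2 * k\<^sup>2 > 0" using \<open>k < 0\<close> by simp
    ultimately show "\<exists>c>0. \<forall>x. norm x = 1 \<longrightarrow> inner (R x) x \<le> k \<longrightarrow>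
        c \<le> inner (R x) (V x) + inner (R (V x)) x - 2 * inner (R x) x * inner x (V x)"
      by blast
  qed
  then show ?thesis by (simp add: R_def inner_add_left)
qed

section \<open>Square roots of bounded accretive operators\<close>

text \<open>
  Commutation gives \<open>(P + R) (P x - R x) = (s\<^sup>2 - t\<^sup>2) x\<close>, and \<open>P + R\<close> is bounded below by \<open>s + t\<close>.
\<close>

lemma shifted_roots_close:
  fixes T P R :: "'a::real_inner \<Rightarrow> 'a"
  assumes P: "linear P" and R: "linear R" and st: "s + t > 0"
    and commute: "P (R x) = R (P x)"
    and P2: "P (P x) = T x + s\<^sup>2 *\<^sub>R x" and R2: "R (R x) = T x + t\<^sup>2 *\<^sub>R x"
    and Pb: "\<And>x. s * (norm x)\<^sup>2 \<le> inner (P x) x" and Rb: "\<And>x. t * (norm x)\<^sup>2 \<le> inner (R x) x"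
  shows "norm (P x - R x) \<le> \<bar>s - t\<bar> * norm x"
proof -
  define y where "y = P x - R x"
  have eq: "P y + R y = (s\<^sup>2 - t\<^sup>2) *\<^sub>R x"
    using commute by (simp add: y_def linear_diff[OF P] linear_diff[OF R] P2 R2 scaleR_left_diff_distrib)
  have "(s + t) * (norm y)\<^sup>2 \<le> inner (P y + R y) y"
    using Pb[of y] Rb[of y] by (simp add: inner_add_left algebra_simps)
  also have "\<dots> = (s\<^sup>2 - t\<^sup>2) * inner x y"
    by (simp add: eq)
  also have "\<dots> \<le> \<bar>s\<^sup>2 - t\<^sup>2\<bar> * (norm x * norm y)"
    using mult_left_mono[OF Cauchy_Schwarz_ineq2[of x y], of "\<bar>s\<^sup>2 - t\<^sup>2\<bar>"]
      abs_ge_self[of "(s\<^sup>2 - t\<^sup>2) * inner x y"] by (simp add: abs_mult)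
  also have "\<bar>s\<^sup>2 - t\<^sup>2\<bar> = (s + t) * \<bar>s - t\<bar>"
    using st by (simp add: power2_eq_square square_diff_square_factored abs_mult)
  finally have "norm y * norm y \<le> (\<bar>s - t\<bar> * norm x) * norm y"
    using st by (simp add: power2_eq_square mult.assoc)
  then show ?thesis
    unfolding y_def[symmetric] by (cases "y = 0") auto
qed

lemma blinfun_eq_iff: "f = g \<longleftrightarrow> (\<forall>x. blinfun_apply f x = blinfun_apply g x)"
  by (auto intro: blinfun_eqI)

text \<open>
  The equation for \<open>Y\<close> says \<open>(I - Y)\<^sup>2 = I - A\<close>. Its solution is the fixed point of
  \<open>Y \<mapsto> (A + Y\<^sup>2) / 2\<close>, a contraction with factor \<open>norm A\<close> on the ball of radius \<open>norm A\<close>, even without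
  commutativity, as \<open>Y\<^sup>2 - Z\<^sup>2 = Y (Y - Z) + (Y - Z) Z\<close>. Restricting the ball to the bicommutant of \<open>A\<close>,
  which is closed and preserved by the map, puts the fixed point there.
\<close>

lemma sqrt_of_id_minus:
  fixes A :: "'a::banach \<Rightarrow>\<^sub>L 'a"
  assumes A: "norm A < 1"
  obtains Y where "norm Y \<le> norm A" and "A + (Y o\<^sub>L Y) = 2 *\<^sub>R Y"
    and "\<And>V. A o\<^sub>L V = V o\<^sub>L A \<Longrightarrow> Y o\<^sub>L V = V o\<^sub>L Y"
proof -
  interpret comp: bounded_bilinear "(o\<^sub>L) :: ('a \<Rightarrow>\<^sub>L 'a) \<Rightarrow> ('a \<Rightarrow>\<^sub>L 'a) \<Rightarrow> ('a \<Rightarrow>\<^sub>L 'a)"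
    by (rule bounded_bilinear_blinfun_compose)
  define D where "D = cball 0 (norm A) \<inter> {Y. \<forall>V. A o\<^sub>L V = V o\<^sub>L A \<longrightarrow> Y o\<^sub>L V = V o\<^sub>L Y}"
  define f where "f Y = (1/2) *\<^sub>R (A + (Y o\<^sub>L Y))" for Y :: "'a \<Rightarrow>\<^sub>L 'a"
  have "closed D"
  proof -
    have "{Y. \<forall>V. A o\<^sub>L V = V o\<^sub>L A \<longrightarrow> Y o\<^sub>L V = V o\<^sub>L Y} =
        (\<Inter>V\<in>{V. A o\<^sub>L V = V o\<^sub>L A}. {Y. Y o\<^sub>L V = V o\<^sub>L Y})"
      by auto
    moreover have "closed {Y. Y o\<^sub>L V = V o\<^sub>L Y}" for V :: "'a \<Rightarrow>\<^sub>L 'a"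
      by (intro closed_Collect_eq comp.continuous_on continuous_intros)
    ultimately show ?thesis unfolding D_def by (simp add: closed_Int closed_INT)
  qed
  have D_norm: "norm Y \<le> norm A" if "Y \<in> D" for Y
    using that unfolding D_def by simp
  have D_comm: "Y o\<^sub>L V = V o\<^sub>L Y" if "Y \<in> D" "A o\<^sub>L V = V o\<^sub>L A" for Y V
    using that unfolding D_def by blast
  have "f Y \<in> D" if Y: "Y \<in> D" for Y
  proof -
    have "norm (Y o\<^sub>L Y) \<le> norm A * norm A"
      using D_norm[OF Y] by (intro order_trans[OF norm_blinfun_compose] mult_mono) auto
    also have "\<dots> \<le> norm A * 1"
      using A by (intro mult_left_mono) auto
    finally have "norm (f Y) \<le> norm A"
      using norm_triangle_ineq[of A "Y o\<^sub>L Y"] by (simp add: f_def)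
    moreover have "f Y o\<^sub>L V = V o\<^sub>L f Y" if V: "A o\<^sub>L V = V o\<^sub>L A" for V
    proof -
      have "Y o\<^sub>L V = V o\<^sub>L Y" by (rule D_comm[OF Y V])
      then have "(Y o\<^sub>L Y) o\<^sub>L V = V o\<^sub>L (Y o\<^sub>L Y)"
        by (simp add: blinfun_eq_iff)
      with V show ?thesis
        by (simp add: f_def comp.add_left comp.add_right comp.scaleR_left comp.scaleR_right)
    qed
    ultimately show ?thesis unfolding D_def by simp
  qed
  moreover have "dist (f Y) (f Z) \<le> norm A * dist Y Z" if "Y \<in> D" "Z \<in> D" for Y Z
  proof -
    have "f Y - f Z = (1/2) *\<^sub>R ((Y o\<^sub>L (Y - Z)) + ((Y - Z) o\<^sub>L Z))"
      by (simp add: f_def comp.diff_left comp.diff_right flip: scaleR_right_diff_distrib)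
    moreover have "norm ((Y o\<^sub>L (Y - Z)) + ((Y - Z) o\<^sub>L Z)) \<le> 2 * (norm A * norm (Y - Z))"
    proof -
      have "norm (Y o\<^sub>L (Y - Z)) \<le> norm A * norm (Y - Z)"
        using D_norm[OF that(1)] by (intro order_trans[OF norm_blinfun_compose] mult_right_mono) auto
      moreover have "norm ((Y - Z) o\<^sub>L Z) \<le> norm (Y - Z) * norm A"
        using D_norm[OF that(2)] by (intro order_trans[OF norm_blinfun_compose] mult_left_mono) auto
      ultimately show ?thesis
        using norm_triangle_ineq[of "Y o\<^sub>L (Y - Z)" "(Y - Z) o\<^sub>L Z"] by (simp add: mult.commute)
    qed
    ultimately show ?thesis by (simp add: dist_norm)
  qed
  moreover have "0 \<in> D" unfolding D_def by simp
  ultimately have "\<exists>!Y\<in>D. f Y = Y"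
    using A \<open>closed D\<close> by (intro Banach_fix[of _ "norm A"]) (auto simp: complete_eq_closed)
  then obtain Y where Y: "Y \<in> D" "f Y = Y" by blast
  have "A + (Y o\<^sub>L Y) = 2 *\<^sub>R Y"
    using arg_cong[OF Y(2), of "scaleR 2"] unfolding f_def by simp
  then show ?thesis
    using that[of Y] D_norm[OF Y(1)] D_comm[OF Y(1)] by blast
qed

text \<open>
  Coercivity makes \<open>norm (I - c A) < 1\<close> for small \<open>c > 0\<close>, since
  \<open>(norm (x - c A x))\<^sup>2 \<le> (1 - 2 c \<epsilon> + c\<^sup>2 M\<^sup>2) (norm x)\<^sup>2\<close> if \<open>norm A \<le> M\<close>. The root of \<open>c A\<close> is then \<open>I - Y\<close>
  with \<open>norm Y < 1\<close>, which is monotone.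
\<close>

lemma coercive_sqrt:
  fixes A :: "'a::{real_inner,banach} \<Rightarrow>\<^sub>L 'a"
  assumes \<epsilon>: "\<epsilon> > 0" and coercive: "\<And>x. \<epsilon> * (norm x)\<^sup>2 \<le> inner (A x) x"
  obtains S :: "'a \<Rightarrow>\<^sub>L 'a" where "S o\<^sub>L S = A" and "\<And>x. inner (S x) x \<ge> 0"
    and "\<And>V. A o\<^sub>L V = V o\<^sub>L A \<Longrightarrow> S o\<^sub>L V = V o\<^sub>L S"
proof -
  interpret comp: bounded_bilinear "(o\<^sub>L) :: ('a \<Rightarrow>\<^sub>L 'a) \<Rightarrow> ('a \<Rightarrow>\<^sub>L 'a) \<Rightarrow> ('a \<Rightarrow>\<^sub>L 'a)"
    by (rule bounded_bilinear_blinfun_compose)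
  define M where "M = norm A + \<epsilon>"
  \<comment> \<open>This \<open>c\<close> minimises \<open>1 - 2 c \<epsilon> + c\<^sup>2 M\<^sup>2\<close>.\<close>
  define c where "c = \<epsilon> / M\<^sup>2"
  have M: "M > 0" "\<epsilon> \<le> M" using \<epsilon> by (simp_all add: M_def add_nonneg_pos)
  have c: "c > 0" "c * M\<^sup>2 = \<epsilon>" using \<epsilon> M by (simp_all add: c_def)
  have "c * \<epsilon> \<le> 1"
    using M \<epsilon> by (simp add: c_def power2_eq_square mult_mono)
  define G where "G = id_blinfun - c *\<^sub>R A"
  have "norm G \<le> sqrt (1 - c * \<epsilon>)"
  proof (rule norm_blinfun_bound)
    fix x
    have "norm (A x) \<le> M * norm x"
      using norm_blinfun[of A x] \<epsilon> by (simp add: M_def algebra_simps add_increasing)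
    then have "(norm (A x))\<^sup>2 \<le> M\<^sup>2 * (norm x)\<^sup>2"
      by (metis norm_ge_zero power_mono power_mult_distrib)
    have "(norm (G x))\<^sup>2 = (norm x)\<^sup>2 - 2 * c * inner (A x) x + c\<^sup>2 * (norm (A x))\<^sup>2"
    proof -
      have "(norm (u - v))\<^sup>2 = (norm u)\<^sup>2 - 2 * inner v u + (norm v)\<^sup>2" for u v :: 'a
        by (simp add: power2_norm_eq_inner inner_diff inner_commute)
      from this[of x "c *\<^sub>R A x"] show ?thesis
        by (simp add: G_def blinfun.bilinear_simps power_mult_distrib)
    qed
    also have "\<dots> \<le> (norm x)\<^sup>2 - 2 * c * (\<epsilon> * (norm x)\<^sup>2) + c\<^sup>2 * (M\<^sup>2 * (norm x)\<^sup>2)"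
      using coercive[of x] \<open>(norm (A x))\<^sup>2 \<le> _\<close> c
      by (intro add_mono diff_mono mult_left_mono) auto
    also have "c\<^sup>2 * (M\<^sup>2 * (norm x)\<^sup>2) = c * (c * M\<^sup>2) * (norm x)\<^sup>2"
      by (simp add: power2_eq_square mult_ac)
    also have "(norm x)\<^sup>2 - 2 * c * (\<epsilon> * (norm x)\<^sup>2) + \<dots> = (1 - c * \<epsilon>) * (norm x)\<^sup>2"
      unfolding c(2) by (simp add: algebra_simps)
    finally have "sqrt ((norm (G x))\<^sup>2) \<le> sqrt ((1 - c * \<epsilon>) * (norm x)\<^sup>2)"
      by (rule real_sqrt_le_mono)
    then show "norm (G x) \<le> sqrt (1 - c * \<epsilon>) * norm x"
      by (simp add: real_sqrt_mult)
  qed (use \<open>c * \<epsilon> \<le> 1\<close> in simp)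
  also have "\<dots> < 1" using c \<epsilon> by simp
  finally have "norm G < 1" .
  then obtain Y where Y: "norm Y \<le> norm G" "G + (Y o\<^sub>L Y) = 2 *\<^sub>R Y"
    "\<And>V. G o\<^sub>L V = V o\<^sub>L G \<Longrightarrow> Y o\<^sub>L V = V o\<^sub>L Y"
    using sqrt_of_id_minus by blast
  define S where "S = (1 / sqrt c) *\<^sub>R (id_blinfun - Y)"
  show thesis
  proof (rule that[of S])
    show "S o\<^sub>L S = A"
    proof (rule blinfun_eqI)
      fix x
      have "Y (Y x) = 2 *\<^sub>R Y x - G x"
        using arg_cong[OF Y(2), of "\<lambda>F. blinfun_apply F x"]
        by (simp add: blinfun.bilinear_simps algebra_simps)
      moreover have "S (S x) = (1 / c) *\<^sub>R (x - 2 *\<^sub>R Y x + Y (Y x))"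
        using c by (simp add: S_def blinfun.bilinear_simps scaleR_2 flip: scaleR_right_diff_distrib)
      ultimately show "(S o\<^sub>L S) x = A x"
        using c by (simp add: G_def blinfun.bilinear_simps)
    qed
    show "inner (S x) x \<ge> 0" for x
    proof -
      have "norm (Y x) \<le> norm x"
        using norm_blinfun[of Y x] mult_right_mono[of "norm Y" 1 "norm x"] Y(1) \<open>norm G < 1\<close> by simp
      then have "norm (Y x) * norm x \<le> norm x * norm x"
        by (intro mult_right_mono) auto
      then have "inner (Y x) x \<le> inner x x"
        using norm_cauchy_schwarz[of "Y x" x] by (simp add: dot_square_norm power2_eq_square)
      then show ?thesis
        using c by (simp add: S_def blinfun.bilinear_simps inner_diff_left)
    qed
    show "S o\<^sub>L V = V o\<^sub>L S" if "A o\<^sub>L V = V o\<^sub>L A" for V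
    proof -
      have "G o\<^sub>L V = V o\<^sub>L G"
        using that by (simp add: G_def blinfun_eq_iff blinfun.bilinear_simps)
      then have "Y o\<^sub>L V = V o\<^sub>L Y" by (rule Y(3))
      then show ?thesis
        by (simp add: S_def blinfun_eq_iff blinfun.bilinear_simps)
    qed
  qed
qed

lemma shifted_sqrt:
  fixes T :: "'a::{real_inner,banach} \<Rightarrow>\<^sub>L 'a"
  assumes mono: "\<And>x. inner (T x) x \<ge> 0" and s: "s > 0"
  obtains P where "P o\<^sub>L P = T + s\<^sup>2 *\<^sub>R id_blinfun" and "\<And>x. s * (norm x)\<^sup>2 \<le> inner (P x) x"
    and "\<And>V. T o\<^sub>L V = V o\<^sub>L T \<Longrightarrow> P o\<^sub>L V = V o\<^sub>L P"
proof -
  let ?A = "T + s\<^sup>2 *\<^sub>R id_blinfun"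
  have A: "s\<^sup>2 * (norm x)\<^sup>2 \<le> inner (?A x) x" for x
    using mono[of x] by (simp add: blinfun.bilinear_simps inner_add_left dot_square_norm)
  obtain P where P: "P o\<^sub>L P = ?A" "\<And>x. inner (P x) x \<ge> 0"
    "\<And>V. ?A o\<^sub>L V = V o\<^sub>L ?A \<Longrightarrow> P o\<^sub>L V = V o\<^sub>L P"
    using coercive_sqrt[OF zero_less_power[OF s] A] by blast
  show thesis
  proof (rule that[of P])
    show "s * (norm x)\<^sup>2 \<le> inner (P x) x" for x
    proof (rule sqrt_lower_bound[OF blinfun.bounded_linear_right P(2)])
      show "s\<^sup>2 * (norm x)\<^sup>2 \<le> inner (P (P x)) x" for x
        using A[of x] P(1) by (metis blinfun_apply_blinfun_compose)
    qed
    show "P o\<^sub>L V = V o\<^sub>L P" if "T o\<^sub>L V = V o\<^sub>L T" for V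
      using that by (intro P(3)) (simp add: blinfun_eq_iff blinfun.bilinear_simps)
  qed (rule P(1))
qed

text \<open>
  A root \<open>S\<close> of \<open>T\<close> commutes with \<open>T = S\<^sup>2\<close>, hence with the root \<open>P\<close> of \<open>T + s\<^sup>2\<close> from \<open>shifted_sqrt\<close>. So all
  monotone roots of \<open>T\<close> are within \<open>s\<close> of the same \<open>P\<close>, for every \<open>s > 0\<close>.
\<close>

lemma monotone_sqrt_unique:
  fixes T S R :: "'a::{real_inner,banach} \<Rightarrow>\<^sub>L 'a"
  assumes T: "\<And>x. inner (T x) x \<ge> 0"
    and S: "S o\<^sub>L S = T" "\<And>x. inner (S x) x \<ge> 0"
    and R: "R o\<^sub>L R = T" "\<And>x. inner (R x) x \<ge> 0"
  shows "S = R"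
proof (rule blinfun_eqI)
  fix x
  have close: "\<exists>P :: 'a \<Rightarrow>\<^sub>L 'a. \<forall>S. S o\<^sub>L S = T \<longrightarrow> (\<forall>x. inner (S x) x \<ge> 0) \<longrightarrow> norm (P x - S x) \<le> s * norm x"
    if "s > 0" for s
  proof -
    obtain P where P: "P o\<^sub>L P = T + s\<^sup>2 *\<^sub>R id_blinfun" "\<And>x. s * (norm x)\<^sup>2 \<le> inner (P x) x"
      "\<And>V. T o\<^sub>L V = V o\<^sub>L T \<Longrightarrow> P o\<^sub>L V = V o\<^sub>L P"
      using shifted_sqrt[OF T \<open>s > 0\<close>] by blast
    have "norm (P x - S x) \<le> s * norm x" if S: "S o\<^sub>L S = T" "\<And>x. inner (S x) x \<ge> 0" for S
    proof -
      have "T o\<^sub>L S = S o\<^sub>L T"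
        by (simp add: blinfun_eq_iff flip: S(1))
      then have PS: "P o\<^sub>L S = S o\<^sub>L P"
        by (rule P(3))
      have "norm (P x - S x) \<le> \<bar>s - 0\<bar> * norm x"
      proof (rule shifted_roots_close[where T = T])
        show "P (S x) = S (P x)" using PS by (simp add: blinfun_eq_iff)
        show "P (P x) = T x + s\<^sup>2 *\<^sub>R x"
          using P(1) by (simp add: blinfun_eq_iff blinfun.bilinear_simps)
        show "S (S x) = T x + 0\<^sup>2 *\<^sub>R x"
          using S(1) by (simp add: blinfun_eq_iff)
      qed (use \<open>s > 0\<close> P(2) S(2) in \<open>auto intro: bounded_linear.linear blinfun.bounded_linear_right\<close>)
      with \<open>s > 0\<close> show ?thesis by simp
    qed
    then show ?thesis by blast
  qed
  have le: "norm (S x - R x) \<le> s * norm x" if s: "s > 0" for s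
  proof -
    obtain P :: "'a \<Rightarrow>\<^sub>L 'a" where "norm (P x - S x) \<le> s / 2 * norm x" "norm (P x - R x) \<le> s / 2 * norm x"
      using close[OF half_gt_zero[OF s]] S R by blast
    then show ?thesis
      using norm_triangle_ineq4[of "P x - R x" "P x - S x"] by simp
  qed
  have "norm (S x - R x) \<le> 0"
  proof (rule field_le_epsilon)
    fix e :: real assume "e > 0"
    then have "norm (S x - R x) \<le> e / (norm x + 1) * norm x"
      by (intro le) (simp add: add_nonneg_pos)
    also have "\<dots> = e * (norm x / (norm x + 1))"
      by simp
    also have "norm x / (norm x + 1) \<le> 1"
      using norm_ge_zero[of x] by (simp add: divide_le_eq_1 del: norm_ge_zero)
    then have "e * (norm x / (norm x + 1)) \<le> e * 1"
      using \<open>e > 0\<close> by (intro mult_left_mono) auto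
    finally show "norm (S x - R x) \<le> 0 + e" by simp
  qed
  then show "S x = R x" by simp
qed

text \<open>
  The roots of \<open>T + s\<^sup>2\<close> commute with each other, since they lie in the bicommutant of \<open>T\<close>, so they form a
  Cauchy sequence as \<open>s \<rightarrow> 0\<close>. Commutation with all \<open>V\<close> that commute with \<open>T\<close> passes to the limit; it is
  what makes the root complex linear, by taking for \<open>V\<close> the imaginary scalars.
\<close>

lemma monotone_sqrt_exists:
  fixes T :: "'a::{real_inner,banach} \<Rightarrow>\<^sub>L 'a"
  assumes T: "\<And>x. inner (T x) x \<ge> 0"
  obtains S where "S o\<^sub>L S = T" and "\<And>x. inner (S x) x \<ge> 0"
    and "\<And>V. T o\<^sub>L V = V o\<^sub>L T \<Longrightarrow> S o\<^sub>L V = V o\<^sub>L S"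
proof -
  interpret comp: bounded_bilinear "(o\<^sub>L) :: ('a \<Rightarrow>\<^sub>L 'a) \<Rightarrow> ('a \<Rightarrow>\<^sub>L 'a) \<Rightarrow> ('a \<Rightarrow>\<^sub>L 'a)"
    by (rule bounded_bilinear_blinfun_compose)
  define s where "s n = inverse (real (Suc n))" for n
  have s_pos: "s n > 0" for n by (simp add: s_def)
  have s_lim: "s \<longlonglongrightarrow> 0"
    unfolding s_def by (rule LIMSEQ_inverse_real_of_nat)
  have "\<exists>P. P o\<^sub>L P = T + (s n)\<^sup>2 *\<^sub>R id_blinfun \<and> (\<forall>x. s n * (norm x)\<^sup>2 \<le> inner (P x) x) \<and>
      (\<forall>V. T o\<^sub>L V = V o\<^sub>L T \<longrightarrow> P o\<^sub>L V = V o\<^sub>L P)" for n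
    using shifted_sqrt[OF T s_pos] by metis
  then obtain P where P2: "\<And>n. P n o\<^sub>L P n = T + (s n)\<^sup>2 *\<^sub>R id_blinfun"
    and P_ge: "\<And>n x. s n * (norm x)\<^sup>2 \<le> inner (P n x) x"
    and P_comm: "\<And>n V. T o\<^sub>L V = V o\<^sub>L T \<Longrightarrow> P n o\<^sub>L V = V o\<^sub>L P n"
    by metis
  have dist_P: "norm (P m - P n) \<le> \<bar>s m - s n\<bar>" for m n
  proof (rule norm_blinfun_bound)
    fix x
    have "T o\<^sub>L P n = P n o\<^sub>L T"
      using P_comm[of T n] by simp
    then have PP: "P m o\<^sub>L P n = P n o\<^sub>L P m"
      by (rule P_comm)
    have "norm (P m x - P n x) \<le> \<bar>s m - s n\<bar> * norm x"
    proof (rule shifted_roots_close[where T = T])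
      show "P m (P n x) = P n (P m x)" using PP by (simp add: blinfun_eq_iff)
      show "P m (P m x) = T x + (s m)\<^sup>2 *\<^sub>R x" "P n (P n x) = T x + (s n)\<^sup>2 *\<^sub>R x" for x
        using P2 by (simp_all add: blinfun_eq_iff blinfun.bilinear_simps)
    qed (use s_pos[of m] s_pos[of n] P_ge in \<open>auto intro: bounded_linear.linear blinfun.bounded_linear_right\<close>)
    then show "norm ((P m - P n) x) \<le> \<bar>s m - s n\<bar> * norm x"
      by (simp add: blinfun.bilinear_simps)
  qed simp
  have "Cauchy P"
  proof (rule CauchyI)
    fix e :: real assume "e > 0"
    then obtain N where "\<And>m n. m \<ge> N \<Longrightarrow> n \<ge> N \<Longrightarrow> norm (s m - s n) < e"
      using CauchyD[OF LIMSEQ_imp_Cauchy[OF s_lim]] by blast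
    then have "norm (P m - P n) < e" if "m \<ge> N" "n \<ge> N" for m n
      using dist_P[of m n] that by fastforce
    then show "\<exists>N. \<forall>m\<ge>N. \<forall>n\<ge>N. norm (P m - P n) < e"
      by blast
  qed
  then obtain S where S: "P \<longlonglongrightarrow> S"
    using Cauchy_convergent_iff convergent_def by blast
  show thesis
  proof (rule that[of S])
    have "(\<lambda>n. P n o\<^sub>L P n) \<longlonglongrightarrow> (S o\<^sub>L S)"
      by (intro comp.tendsto S)
    moreover have "(\<lambda>n. P n o\<^sub>L P n) \<longlonglongrightarrow> T + 0\<^sup>2 *\<^sub>R id_blinfun"
      unfolding P2 by (intro tendsto_intros s_lim)
    ultimately show "S o\<^sub>L S = T"
      using LIMSEQ_unique by fastforce
    show "inner (S x) x \<ge> 0" for x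
    proof (rule LIMSEQ_le_const)
      show "(\<lambda>n. inner (P n x) x) \<longlonglongrightarrow> inner (S x) x"
        by (intro tendsto_intros S)
      show "\<exists>N. \<forall>n\<ge>N. 0 \<le> inner (P n x) x"
      proof (intro exI allI impI)
        show "0 \<le> inner (P n x) x" for n
          using P_ge[of n x] s_pos[of n] by (meson order_trans mult_nonneg_nonneg less_imp_le zero_le_power2)
      qed
    qed
    show "S o\<^sub>L V = V o\<^sub>L S" if "T o\<^sub>L V = V o\<^sub>L T" for V
    proof (rule LIMSEQ_unique)
      show "(\<lambda>n. P n o\<^sub>L V) \<longlonglongrightarrow> (S o\<^sub>L V)"
        by (intro comp.tendsto S tendsto_const)
      show "(\<lambda>n. P n o\<^sub>L V) \<longlonglongrightarrow> (V o\<^sub>L S)"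
        unfolding P_comm[OF that] by (intro comp.tendsto S tendsto_const)
    qed
  qed
qed


section \<open>The square root of an everywhere defined accretive operator\<close>

instance complex_hilbert \<subseteq> banach ..

lemma inner_scaleC_self:
  fixes x :: "'a::complex_inner"
  shows "inner (c *\<^sub>C x) x = Re c * (norm x)\<^sup>2"
proof -
  have "Im (cinner x x) = 0"
    using arg_cong[OF cinner_commute[of x x], of Im] by simp
  then show ?thesis
    by (simp add: inner_eq_Re_cinner cinner_scaleC_left power2_norm_eq_inner)
qed

lemma scaleC_minus_left: "(- c) *\<^sub>C x = - (c *\<^sub>C x)"
  and scaleC_minus_right: "c *\<^sub>C (- x) = - (c *\<^sub>C x)"
  and scaleC_diff_right: "c *\<^sub>C (x - y) = c *\<^sub>C x - c *\<^sub>C y"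
  for x y :: "'a::complex_inner"
proof -
  have *: "of_real (-1) *\<^sub>C y = - y" for y :: 'a
    using scaleC_of_real[of "-1" y] by simp
  show "(- c) *\<^sub>C x = - (c *\<^sub>C x)"
    using *[of "c *\<^sub>C x"] by (simp add: scaleC_scaleC)
  show neg: "c *\<^sub>C (- x) = - (c *\<^sub>C x)" for x :: 'a
    using *[of "c *\<^sub>C x"] *[of x] by (metis mult.commute scaleC_scaleC)
  show "c *\<^sub>C (x - y) = c *\<^sub>C x - c *\<^sub>C y"
    using scaleC_add_right[of c x "- y"] by (simp add: neg)
qed

lemma scaleR_eq_scaleC: "r *\<^sub>R x = complex_of_real r *\<^sub>C x" for x :: "'a::complex_inner"
  by (simp add: scaleC_of_real)

lemma bounded_linear_scaleC_imaginary:
  "bounded_linear (\<lambda>x::'a::complex_inner. (of_real r * \<i>) *\<^sub>C x)"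
proof (rule bounded_linear_intro[where K = "\<bar>r\<bar>"])
  fix x :: 'a
  let ?c = "of_real r * \<i>"
  have "cinner x (?c *\<^sub>C x) = cnj ?c * cinner x x"
    by (metis cinner_commute cinner_scaleC_left complex_cnj_mult)
  then have "inner (?c *\<^sub>C x) (?c *\<^sub>C x) = r\<^sup>2 * inner x x"
    by (simp add: inner_eq_Re_cinner cinner_scaleC_left power2_eq_square)
  then have "(norm (?c *\<^sub>C x))\<^sup>2 = r\<^sup>2 * (norm x)\<^sup>2"
    by (simp only: power2_norm_eq_inner)
  then have "(norm (?c *\<^sub>C x))\<^sup>2 = (norm x * \<bar>r\<bar>)\<^sup>2"
    by (simp add: power_mult_distrib)
  then show "norm (?c *\<^sub>C x) \<le> norm x * \<bar>r\<bar>"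
    by (metis abs_ge_zero mult_nonneg_nonneg norm_ge_zero order_refl power2_eq_imp_eq)
qed (simp_all add: scaleC_add_right scaleR_eq_scaleC scaleC_scaleC mult_ac)

lemma total_accretive_obtain:
  fixes A :: "'a::complex_hilbert operator"
  assumes A: "accretive A" and total: "dom A = UNIV"
  obtains F :: "'a \<Rightarrow>\<^sub>L 'a" where "\<And>x. A x = Some (F x)" and "\<And>c x. F (c *\<^sub>C x) = c *\<^sub>C F x"
    and "\<And>x. inner (F x) x \<ge> 0"
proof -
  define f where "f x = the (A x)" for x
  have Af: "A x = Some (f x)" for x
    using total by (metis UNIV_I domIff f_def option.collapse)
  have f_add: "f (x + y) = f x + f y" and f_scale: "f (c *\<^sub>C x) = c *\<^sub>C f x" for x y c
    using A unfolding accretive_def linear_op_def Af by auto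
  have mono: "inner (f x) x \<ge> 0" for x
    using A total by (simp add: accretive_def Af inner_eq_Re_cinner)
  have "linear f"
    by (intro linearI) (simp_all add: f_add f_scale scaleR_eq_scaleC)
  then have bl: "bounded_linear f"
    using mono by (rule monotone_linear_bounded)
  show thesis
    by (rule that[of "Blinfun f"]) (simp_all add: bounded_linear_Blinfun_apply[OF bl] Af f_scale mono)
qed

text \<open>
  For \<open>r > norm F\<close> the equation \<open>r x + F x = y\<close> is the fixed point equation of the contraction
  \<open>x \<mapsto> (y - F x) / r\<close>.
\<close>

lemma m_accretive_total:
  fixes F :: "'a::complex_hilbert \<Rightarrow>\<^sub>L 'a"
  assumes scale: "\<And>c x. F (c *\<^sub>C x) = c *\<^sub>C F x" and mono: "\<And>x. inner (F x) x \<ge> 0"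
  shows "m_accretive (\<lambda>x. Some (F x))"
proof -
  define r where "r = norm F + 1"
  have "r > 0" by (simp add: r_def add_nonneg_pos)
  have "\<exists>x. of_real r *\<^sub>C x + F x = y" for y
  proof -
    define h where "h x = (1 / r) *\<^sub>R (y - F x)" for x
    have "dist (h x) (h z) \<le> norm F / r * dist x z" for x z
    proof -
      have "h x - h z = (1 / r) *\<^sub>R F (z - x)"
        by (simp add: h_def blinfun.diff_right flip: scaleR_right_diff_distrib)
      moreover have "norm (F (z - x)) \<le> norm F * norm (x - z)"
        using norm_blinfun[of F "z - x"] by (simp add: norm_minus_commute)
      ultimately show ?thesis
        using \<open>r > 0\<close> by (simp add: dist_norm divide_right_mono)
    qed
    then have "\<exists>!x. h x = x"
      using \<open>r > 0\<close> by (intro banach_fix_type[of "norm F / r"]) (auto simp: r_def)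
    then obtain x where "h x = x" by blast
    moreover have "r *\<^sub>R h x = y - F x"
      using \<open>r > 0\<close> by (simp add: h_def)
    ultimately have "r *\<^sub>R x = y - F x"
      by simp
    then show ?thesis
      by (intro exI[of _ x]) (simp add: scaleC_of_real)
  qed
  then have "ran (complex_of_real r *\<^sub>o Some +\<^sub>o (\<lambda>x. Some (F x))) = UNIV"
    by (auto simp: ran_def op_add_def op_scale_def dom_def)
  then show ?thesis
    unfolding m_accretive_def accretive_def linear_op_def
    using \<open>r > 0\<close> mono by (auto simp: blinfun.bilinear_simps scale dom_def simp flip: inner_eq_Re_cinner)
qed

text \<open>
  This identifies the definite description \<open>op_sqrt A\<close>. The bounded monotone root \<open>S\<close> satisfies the
  sector condition by \<open>sqrt_sector_bound\<close>. A competitor \<open>X\<close> with \<open>X \<circ>\<^sub>m X = A\<close> has full domain, because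
  \<open>dom (X \<circ>\<^sub>m X) \<subseteq> dom X\<close>, so it is bounded as well and equals \<open>S\<close> by \<open>monotone_sqrt_unique\<close>.
\<close>

lemma op_sqrt_total:
  fixes A :: "'a::complex_hilbert operator"
  assumes A: "accretive A" and total: "dom A = UNIV"
  obtains S :: "'a \<Rightarrow>\<^sub>L 'a" where "\<And>x. op_sqrt A x = Some (S x)"
    and "\<And>c x. S (c *\<^sub>C x) = c *\<^sub>C S x" and "\<And>x. A x = Some (S (S x))"
proof -
  obtain F :: "'a \<Rightarrow>\<^sub>L 'a" where AF: "\<And>x. A x = Some (F x)"
    and F_scale: "\<And>c x. F (c *\<^sub>C x) = c *\<^sub>C F x" and F_mono: "\<And>x. inner (F x) x \<ge> 0"
    using total_accretive_obtain[OF A total] by blast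
  obtain S where S2: "S o\<^sub>L S = F" and S_mono: "\<And>x. inner (S x) x \<ge> 0"
    and S_comm: "\<And>V. F o\<^sub>L V = V o\<^sub>L F \<Longrightarrow> S o\<^sub>L V = V o\<^sub>L S"
    using monotone_sqrt_exists[OF F_mono] by blast
  have SS: "S (S x) = F x" for x
    using S2 by (simp add: blinfun_eq_iff)
  have S_imag: "S ((of_real r * \<i>) *\<^sub>C x) = (of_real r * \<i>) *\<^sub>C S x" for r x
  proof -
    define V where "V = Blinfun (\<lambda>x::'a. (of_real r * \<i>) *\<^sub>C x)"
    have V: "V x = (of_real r * \<i>) *\<^sub>C x" for x
      unfolding V_def by (simp add: bounded_linear_Blinfun_apply[OF bounded_linear_scaleC_imaginary])
    have "F o\<^sub>L V = V o\<^sub>L F"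
      by (simp add: blinfun_eq_iff V F_scale)
    then have "S o\<^sub>L V = V o\<^sub>L S" by (rule S_comm)
    then show ?thesis by (simp add: blinfun_eq_iff V)
  qed
  have S_scale: "S (c *\<^sub>C x) = c *\<^sub>C S x" for c x
  proof -
    have c: "c *\<^sub>C y = Re c *\<^sub>R y + (of_real (Im c) * \<i>) *\<^sub>C y" for y :: 'a
      unfolding scaleR_eq_scaleC scaleC_add_left[symmetric]
      by (rule arg_cong[of _ _ "\<lambda>a. a *\<^sub>C y"]) (simp add: complex_eq_iff)
    show ?thesis
      by (simp only: c blinfun.add_right blinfun.scaleR_right S_imag)
  qed
  have sector: "0 \<le> inner (S x) x + inner ((of_real r * \<i>) *\<^sub>C S x) x" if "r\<^sup>2 = 1" for r x
  proof (rule sqrt_sector_bound[of "blinfun_apply S" "\<lambda>x. (of_real r * \<i>) *\<^sub>C x"])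
    have "(of_real r * \<i>) * (of_real r * \<i>) = - of_real (r\<^sup>2)"
      by (simp add: power2_eq_square complex_eq_iff)
    then show "(of_real r * \<i>) *\<^sub>C (of_real r * \<i>) *\<^sub>C x = - x" for x :: 'a
      using that scaleC_of_real[of 1 x] by (simp add: scaleC_scaleC scaleC_minus_left)
  qed (simp_all add: blinfun.bounded_linear_right bounded_linear_scaleC_imaginary inner_scaleC_self
        S_imag S_mono SS F_mono)
  have "\<bar>Im (cinner (S x) x)\<bar> \<le> Re (cinner (S x) x)" for x
    using sector[of 1 x] sector[of "-1" x] by (simp add: inner_eq_Re_cinner cinner_scaleC_left)
  then have angle: "m_angle_accretive (pi / 4) (\<lambda>x. Some (S x))"
    using m_accretive_total[OF S_scale S_mono] by (simp add: m_angle_accretive_def tan_45)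
  have "op_sqrt A = (\<lambda>x. Some (S x))"
    unfolding op_sqrt_def
  proof (rule the_equality)
    show "m_angle_accretive (pi / 4) (\<lambda>x. Some (S x)) \<and> (\<lambda>x. Some (S x)) \<circ>\<^sub>m (\<lambda>x. Some (S x)) = A"
      using angle by (auto simp: map_comp_def AF SS)
  next
    fix X assume X: "m_angle_accretive (pi / 4) X \<and> X \<circ>\<^sub>m X = A"
    then have XX: "(X \<circ>\<^sub>m X) x = Some (F x)" for x
      by (simp add: AF)
    have "X x \<noteq> None" for x
      using XX[of x] by (cases "X x") auto
    then have "dom X = UNIV" by auto
    have "accretive X"
      using X by (simp add: m_angle_accretive_def m_accretive_def)
    then obtain G :: "'a \<Rightarrow>\<^sub>L 'a" where XG: "\<And>x. X x = Some (G x)" and G: "\<And>x. inner (G x) x \<ge> 0"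
      using total_accretive_obtain[OF _ \<open>dom X = UNIV\<close>] by metis
    have "G o\<^sub>L G = F"
      using XX by (simp add: blinfun_eq_iff map_comp_def XG)
    then have "G = S"
      by (rule monotone_sqrt_unique[OF F_mono _ G S2 S_mono])
    then show "X = (\<lambda>x. Some (S x))"
      by (simp add: fun_eq_iff XG)
  qed
  then show thesis
    by (intro that[of S]) (simp_all add: S_scale AF SS)
qed

section \<open>Factorisation of the quadratic pencil\<close>

text \<open>
  Write \<open>D\<close> for the domain of \<open>B\<^sup>2\<close>. Invariance gives \<open>B\<^sup>2 x = B (B x) \<in> D\<close> for \<open>x \<in> D\<close>, so
  \<open>r x + B\<^sup>2 x \<in> D\<close>; but these vectors fill the space.
\<close>

lemma dom_square_eq_UNIV:
  fixes B :: "'a::complex_inner operator"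
  assumes B2: "m_accretive (B \<circ>\<^sub>m B)" and inv: "ran (B |` dom (B \<circ>\<^sub>m B)) \<subseteq> dom (B \<circ>\<^sub>m B)"
  shows "dom (B \<circ>\<^sub>m B) = UNIV"
proof -
  let ?D = "dom (B \<circ>\<^sub>m B)"
  have lin: "linear_op (B \<circ>\<^sub>m B)"
    using B2 by (simp add: m_accretive_def accretive_def)
  have D_add: "x + y \<in> ?D" if "x \<in> ?D" "y \<in> ?D" for x y
    using lin that unfolding linear_op_def dom_def by blast
  have D_scale: "c *\<^sub>C x \<in> ?D" if "x \<in> ?D" for c x
    using lin that unfolding linear_op_def dom_def by blast
  have step: "u \<in> ?D" if "x \<in> ?D" "B x = Some u" for x u
    using inv that by (metis ranI restrict_in subsetD)
  obtain r :: real where ran: "ran (complex_of_real r *\<^sub>o Some +\<^sub>o (B \<circ>\<^sub>m B)) = UNIV"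
    using B2 unfolding m_accretive_def by blast
  have "y \<in> ?D" for y
  proof -
    have "y \<in> ran (complex_of_real r *\<^sub>o Some +\<^sub>o (B \<circ>\<^sub>m B))"
      by (simp add: ran)
    then obtain x where x: "x \<in> ?D" and y: "y = of_real r *\<^sub>C x + the ((B \<circ>\<^sub>m B) x)"
      by (auto simp: ran_def op_add_def op_scale_def split: if_splits)
    obtain u v where u: "B x = Some u" and v: "B u = Some v"
      using x by (cases "B x") auto
    have "v \<in> ?D"
      using step[OF step[OF x u] v] .
    then show ?thesis
      using D_add[OF D_scale[OF x]] y u v by simp
  qed
  then show ?thesis by blast
qed

theorem proposition3p5:
  fixes B C \<Lambda> Z1 Z2 :: "'a::complex_hilbert operator"
    and Q :: "complex \<Rightarrow> 'a operator"
    and \<alpha> \<beta> \<delta> :: real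
  assumes "linear_op B" and "linear_op C"
    and "m_accretive (B \<circ>\<^sub>m B)"
    and "accretive C"
    and "dom (B \<circ>\<^sub>m B) \<subseteq> dom C"
    and "\<alpha> \<ge> 0" and "0 \<le> \<beta>" and "\<beta> < 1" and "\<delta> \<ge> 0"
    and "\<forall>x\<in>dom (B \<circ>\<^sub>m B).
           Re (cinner (the ((B \<circ>\<^sub>m B) x)) (the (C x)))
             \<ge> - \<alpha> * (norm x)\<^sup>2 - \<beta> * (norm (the ((B \<circ>\<^sub>m B) x)))\<^sup>2
                - \<delta> * norm (the ((B \<circ>\<^sub>m B) x)) * norm x"
    and "\<Lambda> = (B \<circ>\<^sub>m B) +\<^sub>o C"
    and "Z1 = B +\<^sub>o op_sqrt \<Lambda>"
    and "Z2 = B -\<^sub>o op_sqrt \<Lambda>"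
    and "\<And>\<mu>. Q \<mu> = \<mu>\<^sup>2 *\<^sub>o Some -\<^sub>o (2 * \<mu>) *\<^sub>o B -\<^sub>o C"
    and "ran (B |` dom (B \<circ>\<^sub>m B)) \<subseteq> dom (B \<circ>\<^sub>m B)"
    and "ran (op_sqrt \<Lambda> |` dom (B \<circ>\<^sub>m B)) \<subseteq> dom (B \<circ>\<^sub>m B)"
  shows "(\<forall>\<mu>. \<forall>x\<in>dom (B \<circ>\<^sub>m B).
            x \<in> dom (Q \<mu>) \<and>
            Q \<mu> x = ((1/2) *\<^sub>o ((\<mu> *\<^sub>o Some -\<^sub>o Z1) \<circ>\<^sub>m (\<mu> *\<^sub>o Some -\<^sub>o Z2))
                     +\<^sub>o (1/2) *\<^sub>o ((\<mu> *\<^sub>o Some -\<^sub>o Z2) \<circ>\<^sub>m (\<mu> *\<^sub>o Some -\<^sub>o Z1))) x)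
       \<and> ((\<forall>x\<in>dom (B \<circ>\<^sub>m B). (B \<circ>\<^sub>m op_sqrt \<Lambda>) x = (op_sqrt \<Lambda> \<circ>\<^sub>m B) x) \<longrightarrow>
          (\<forall>\<mu>. \<forall>x\<in>dom (B \<circ>\<^sub>m B).
            x \<in> dom (Q \<mu>) \<and>
            Q \<mu> x = ((\<mu> *\<^sub>o Some -\<^sub>o Z1) \<circ>\<^sub>m (\<mu> *\<^sub>o Some -\<^sub>o Z2)) x \<and>
            Q \<mu> x = ((\<mu> *\<^sub>o Some -\<^sub>o Z2) \<circ>\<^sub>m (\<mu> *\<^sub>o Some -\<^sub>o Z1)) x))"
proof -
  let ?D = "dom (B \<circ>\<^sub>m B)"
  note lin_B = assms(1) and lin_C = assms(2) and B2 = assms(3) and acc_C = assms(4)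
    and \<Lambda> = assms(11) and Z1 = assms(12) and Z2 = assms(13) and Q = assms(14)
  have D: "?D = UNIV"
    using B2 assms(15) by (rule dom_square_eq_UNIV)
  define b where "b x = the (B x)" for x
  define c where "c x = the (C x)" for x
  have B: "B x = Some (b x)" for x
  proof -
    have "x \<in> ?D" by (simp add: D)
    then show ?thesis by (cases "B x") (auto simp: b_def)
  qed
  have C: "C x = Some (c x)" for x
    using assms(5) D by (metis UNIV_I c_def domIff option.collapse subsetD)
  have \<Lambda>_eq: "\<Lambda> x = Some (b (b x) + c x)" for x
    by (simp add: \<Lambda> op_add_def dom_def B C)
  have b_add: "b (x + y) = b x + b y" and b_scale: "b (a *\<^sub>C x) = a *\<^sub>C b x" for x y a
    using lin_B by (auto simp: linear_op_def B)
  have c_add: "c (x + y) = c x + c y" and c_scale: "c (a *\<^sub>C x) = a *\<^sub>C c x" and c_0: "c 0 = 0" for x y a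
    using lin_C by (auto simp: linear_op_def C)
  have b_0: "b 0 = 0" using lin_B by (simp add: linear_op_def B)
  have b_diff: "b (x - y) = b x - b y" for x y
    using b_add[of "x - y" y] by simp
  have "accretive \<Lambda>"
    unfolding accretive_def linear_op_def
  proof (intro conjI allI impI ballI)
    fix x
    have "0 \<le> Re (cinner (b (b x)) x)"
      using B2 D by (simp add: m_accretive_def accretive_def B)
    moreover have "0 \<le> Re (cinner (c x) x)"
      using acc_C by (simp add: accretive_def C dom_def)
    ultimately show "0 \<le> Re (cinner (the (\<Lambda> x)) x)"
      by (simp add: \<Lambda>_eq cinner_add_left)
  qed (auto simp: \<Lambda>_eq b_add c_add b_scale c_scale b_0 c_0 scaleC_add_right)
  moreover have "dom \<Lambda> = UNIV" by (auto simp: \<Lambda>_eq)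
  ultimately obtain S :: "'a \<Rightarrow>\<^sub>L 'a" where S: "\<And>x. op_sqrt \<Lambda> x = Some (S x)"
    and S_scale: "\<And>a x. S (a *\<^sub>C x) = a *\<^sub>C S x" and S2: "\<And>x. \<Lambda> x = Some (S (S x))"
    using op_sqrt_total by blast
  have SS: "S (S x) = b (b x) + c x" for x
    using S2[of x] \<Lambda>_eq[of x] by simp
  \<comment> \<open>Only \<open>\<mu>\<close> itself acts as a scalar here, so that the expansions below are identities in an abelian group.\<close>
  define q where "q \<mu> x = \<mu> *\<^sub>C \<mu> *\<^sub>C x - (\<mu> *\<^sub>C b x + \<mu> *\<^sub>C b x) - c x" for \<mu> x
  define p1 where "p1 \<mu> x = \<mu> *\<^sub>C x - (b x + S x)" for \<mu> x
  define p2 where "p2 \<mu> x = \<mu> *\<^sub>C x - (b x - S x)" for \<mu> x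
  have twice: "(2 * \<mu>) *\<^sub>C y = \<mu> *\<^sub>C y + \<mu> *\<^sub>C y" for \<mu> and y :: 'a
    unfolding mult_2 by (rule scaleC_add_left)
  have Q_eq: "Q \<mu> x = Some (q \<mu> x)" for \<mu> x
    by (simp add: Q op_diff_def op_scale_def dom_def B C q_def scaleC_scaleC power2_eq_square twice)
  have 12: "((\<mu> *\<^sub>o Some -\<^sub>o Z1) \<circ>\<^sub>m (\<mu> *\<^sub>o Some -\<^sub>o Z2)) x = Some (p1 \<mu> (p2 \<mu> x))"
    and 21: "((\<mu> *\<^sub>o Some -\<^sub>o Z2) \<circ>\<^sub>m (\<mu> *\<^sub>o Some -\<^sub>o Z1)) x = Some (p2 \<mu> (p1 \<mu> x))" for \<mu> x
    by (simp_all add: Z1 Z2 op_diff_def op_add_def op_scale_def dom_def map_comp_def B S p1_def p2_def)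
  note expand = q_def p1_def p2_def b_add b_diff b_scale blinfun.add_right blinfun.diff_right S_scale SS
    scaleC_add_right scaleC_diff_right
  have p12: "p1 \<mu> (p2 \<mu> x) = q \<mu> x - (b (S x) - S (b x))"
    and p21: "p2 \<mu> (p1 \<mu> x) = q \<mu> x + (b (S x) - S (b x))" for \<mu> x
    by (simp_all add: expand algebra_simps)
  have half: "(1/2) *\<^sub>C (y - z) + (1/2) *\<^sub>C (y + z) = y" for y z :: 'a
    using scaleC_add_left[of "1/2" "1/2" y] scaleC_of_real[of 1 y]
    by (simp add: scaleC_add_right scaleC_diff_right)
  have average: "((1/2) *\<^sub>o M +\<^sub>o (1/2) *\<^sub>o N) x = Some ((1/2) *\<^sub>C u + (1/2) *\<^sub>C v)"
    if "M x = Some u" "N x = Some v" for M N :: "'a operator" and x u v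
    using that by (simp add: op_add_def op_scale_def dom_def)
  show ?thesis
  proof (intro conjI allI ballI impI)
    fix \<mu> x
    show "x \<in> dom (Q \<mu>)" by (simp add: Q_eq dom_def)
    show "x \<in> dom (Q \<mu>)" by (simp add: Q_eq dom_def)
    show "Q \<mu> x = ((1/2) *\<^sub>o ((\<mu> *\<^sub>o Some -\<^sub>o Z1) \<circ>\<^sub>m (\<mu> *\<^sub>o Some -\<^sub>o Z2))
        +\<^sub>o (1/2) *\<^sub>o ((\<mu> *\<^sub>o Some -\<^sub>o Z2) \<circ>\<^sub>m (\<mu> *\<^sub>o Some -\<^sub>o Z1))) x"
      by (simp only: average[where x = x, OF 12 21] Q_eq p12 p21 half)
  next
    fix \<mu> x
    assume "\<forall>x\<in>?D. (B \<circ>\<^sub>m op_sqrt \<Lambda>) x = (op_sqrt \<Lambda> \<circ>\<^sub>m B) x"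
    then have "b (S x) = S (b x)"
      by (simp add: D B S)
    then show "Q \<mu> x = ((\<mu> *\<^sub>o Some -\<^sub>o Z1) \<circ>\<^sub>m (\<mu> *\<^sub>o Some -\<^sub>o Z2)) x"
      "Q \<mu> x = ((\<mu> *\<^sub>o Some -\<^sub>o Z2) \<circ>\<^sub>m (\<mu> *\<^sub>o Some -\<^sub>o Z1)) x"
      by (simp_all add: 12 21 Q_eq p12 p21)
  qed
qed

end
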